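(* Let $S$ be a commutative normed semigroup and $\phi:S\to S$ an automorphism. Then $h_{\mathfrak S}(\phi^{-1})=h_{\mathfrak S}(\phi)$.
   Context: A normed semigroup $(S,v)$ is a semigroup $(S,\cdot)$ with a function $v:S\to\mathbb R_{\ge0}$. Morphisms are contractive semigroup homomorphisms ($v'(\phi(x))\le v(x)$); an automorphism is an invertible endomorphism in this category, i.e. a bijective semigroup endomorphism such that both $\phi$ and $\phi^{-1}$ are contractive (hence $v(\phi(x))=v(x)$ for all $x$). For $x\in S$, $T_n(\phi,x)=x\cdot\phi(x)\cdots\phi^{n-1}(x)$, $h_{\mathfrak S}(\phi,x)=\limsup_{n\to\infty}\frac{v(T_n(\phi,x))}{n}$, and $h_{\mathfrak S}(\phi)=\sup_{x\in S}h_{\mathfrak S}(\phi,x)\in[0,\infty]$. *)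

theory Defs
  imports "HOL-Analysis.Analysis"
begin

text \<open>The carrier of the semigroup is the whole type and its multiplication is the one of
  the type class; only the norm is an explicit parameter. No compatibility
  between the norm and the multiplication is required.\<close>

definition normed_semigroup :: "('a::semigroup_mult \<Rightarrow> real) \<Rightarrow> bool" where
  "normed_semigroup v \<longleftrightarrow> (\<forall>x. 0 \<le> v x)"

definition semigroup_hom :: "('a::semigroup_mult \<Rightarrow> 'b::semigroup_mult) \<Rightarrow> bool" where
  "semigroup_hom \<phi> \<longleftrightarrow> (\<forall>x y. \<phi> (x * y) = \<phi> x * \<phi> y)"

definition contractive :: "('a \<Rightarrow> real) \<Rightarrow> ('b \<Rightarrow> real) \<Rightarrow> ('a \<Rightarrow> 'b) \<Rightarrow> bool" where
  "contractive v v' \<phi> \<longleftrightarrow> (\<forall>x. v' (\<phi> x) \<le> v x)"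

definition normed_semigroup_automorphism ::
    "('a::semigroup_mult \<Rightarrow> real) \<Rightarrow> ('a \<Rightarrow> 'a) \<Rightarrow> bool" where
  "normed_semigroup_automorphism v \<phi> \<longleftrightarrow>
     semigroup_hom \<phi> \<and> bij \<phi> \<and> contractive v v \<phi> \<and> contractive v v (inv \<phi>)"

text \<open>\<open>trajectory \<phi> x n\<close> is the product \<open>x * \<phi> x * \<dots> * (\<phi> ^^ (n - 1)) x\<close> for \<open>n \<ge> 1\<close>.
  A semigroup has no empty product, so the value at \<open>n = 0\<close> is a dummy; it
  has no influence on the limit superior below.\<close>

fun trajectory :: "('a::semigroup_mult \<Rightarrow> 'a) \<Rightarrow> 'a \<Rightarrow> nat \<Rightarrow> 'a" where
  "trajectory \<phi> x 0 = x"
| "trajectory \<phi> x (Suc 0) = x"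
| "trajectory \<phi> x (Suc (Suc n)) = trajectory \<phi> x (Suc n) * (\<phi> ^^ Suc n) x"

text \<open>The entropies take values in \<open>[0, \<infinity>]\<close>. The coercion \<open>ennreal\<close> truncates negative
  reals to \<open>0\<close>, which never happens when \<open>v\<close> is a norm.\<close>

definition entropy_at ::
    "('a::semigroup_mult \<Rightarrow> real) \<Rightarrow> ('a \<Rightarrow> 'a) \<Rightarrow> 'a \<Rightarrow> ennreal" where
  "entropy_at v \<phi> x = limsup (\<lambda>n. ennreal (v (trajectory \<phi> x n) / real n))"

definition semigroup_entropy ::
    "('a::semigroup_mult \<Rightarrow> real) \<Rightarrow> ('a \<Rightarrow> 'a) \<Rightarrow> ennreal" where
  "semigroup_entropy v \<phi> = (SUP x. entropy_at v \<phi> x)"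

end

theory Submission
  imports Defs
begin

text \<open>By commutativity, \<open>\<phi> ^^ (n - 1)\<close> maps the \<open>n\<close>-th trajectory of \<open>inv \<phi>\<close> at \<open>x\<close> to the
  \<open>n\<close>-th trajectory of \<open>\<phi>\<close> at \<open>x\<close>: it reverses the order of the factors. Since \<open>\<phi>\<close> preserves
  the norm, the two entropies already agree at each point.\<close>

lemma semigroup_hom_mult: "semigroup_hom \<phi> \<Longrightarrow> \<phi> (x * y) = \<phi> x * \<phi> y"
  by (simp add: semigroup_hom_def)

lemma semigroup_hom_funpow:
  fixes \<phi> :: "'a::semigroup_mult \<Rightarrow> 'a"
  shows "semigroup_hom \<phi> \<Longrightarrow> semigroup_hom (\<phi> ^^ n)"
  by (induction n) (auto simp: semigroup_hom_def)

lemma funpow_funpow_inv: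
  fixes \<phi> :: "'a \<Rightarrow> 'a"
  assumes "surj \<phi>"
  shows "(\<phi> ^^ n) ((inv \<phi> ^^ n) x) = x"
proof (induction n)
  case (Suc n)
  \<comment> \<open>\<open>funpow_swap1\<close> moves one \<open>\<phi>\<close> innermost, next to
    the outermost \<open>inv \<phi>\<close>, where surjectivity cancels the pair.\<close>
  have "(\<phi> ^^ Suc n) ((inv \<phi> ^^ Suc n) x) = (\<phi> ^^ n) (\<phi> (inv \<phi> ((inv \<phi> ^^ n) x)))"
    by (simp add: funpow_swap1)
  then show ?case
    using Suc assms by (simp add: surj_f_inv_f)
qed simp

text \<open>The defining recursion adds factors on the right; peeling off the first factor instead
  leaves a homomorphic image of a shorter product. Associativity is enough for this.\<close>

lemma trajectory_Suc_left:
  assumes "semigroup_hom \<phi>"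
  shows "trajectory \<phi> x (Suc (Suc n)) = x * \<phi> (trajectory \<phi> x (Suc n))"
proof (induction n)
  case (Suc n)
  have "trajectory \<phi> x (Suc (Suc (Suc n)))
      = x * (\<phi> (trajectory \<phi> x (Suc n)) * \<phi> ((\<phi> ^^ Suc n) x))"
    by (simp only: trajectory.simps(3)[of _ _ "Suc n"] Suc mult.assoc funpow.simps comp_apply)
  then show ?case
    by (simp only: trajectory.simps(3)[of _ _ n] semigroup_hom_mult[OF assms])
qed simp

text \<open>Indexing by \<open>Suc n\<close> keeps the exponent one below the length and avoids the
  dummy value at 0.\<close>

lemma funpow_trajectory_inv:
  fixes \<phi> :: "'a::ab_semigroup_mult \<Rightarrow> 'a"
  assumes hom: "semigroup_hom \<phi>" and "surj \<phi>"
  shows "(\<phi> ^^ n) (trajectory (inv \<phi>) x (Suc n)) = trajectory \<phi> x (Suc n)"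
proof (induction n)
  case (Suc n)
  have "(\<phi> ^^ Suc n) (trajectory (inv \<phi>) x (Suc (Suc n)))
      = (\<phi> ^^ Suc n) (trajectory (inv \<phi>) x (Suc n)) * (\<phi> ^^ Suc n) ((inv \<phi> ^^ Suc n) x)"
    by (simp only: trajectory.simps semigroup_hom_mult[OF semigroup_hom_funpow[OF hom]])
  \<comment> \<open>The newest factor cancels to \<open>x\<close>; splitting off one
    \<open>\<phi>\<close> exposes the induction hypothesis.\<close>
  also have "\<dots> = \<phi> ((\<phi> ^^ n) (trajectory (inv \<phi>) x (Suc n))) * x"
    unfolding funpow_funpow_inv[OF \<open>surj \<phi>\<close>] by simp
  \<comment> \<open>Commutativity enters here: \<open>x\<close> stands last but is the first factor
    of the target.\<close>
  also have "\<dots> = trajectory \<phi> x (Suc (Suc n))"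
    by (simp only: Suc trajectory_Suc_left[OF hom] mult.commute)
  finally show ?case .
qed simp

lemma automorphism_norm_eq:
  assumes "normed_semigroup_automorphism v \<phi>"
  shows "v (\<phi> x) = v x"
proof (rule antisym)
  show "v (\<phi> x) \<le> v x"
    using assms by (simp add: normed_semigroup_automorphism_def contractive_def)
  have "v (inv \<phi> (\<phi> x)) \<le> v (\<phi> x)"
    using assms by (simp add: normed_semigroup_automorphism_def contractive_def)
  then show "v x \<le> v (\<phi> x)"
    using assms by (simp add: normed_semigroup_automorphism_def bij_is_inj)
qed

lemma automorphism_norm_funpow_eq:
  assumes "normed_semigroup_automorphism v \<phi>"
  shows "v ((\<phi> ^^ n) x) = v x"
  by (induction n) (simp_all add: automorphism_norm_eq[OF assms])

lemma norm_trajectory_inv: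
  fixes v :: "'a::ab_semigroup_mult \<Rightarrow> real"
  assumes "normed_semigroup_automorphism v \<phi>"
  shows "v (trajectory (inv \<phi>) x n) = v (trajectory \<phi> x n)"
proof (cases n)
  case (Suc m)
  have "semigroup_hom \<phi>" "surj \<phi>"
    using assms by (auto simp: normed_semigroup_automorphism_def bij_is_surj)
  then show ?thesis
    using automorphism_norm_funpow_eq[OF assms, of m "trajectory (inv \<phi>) x n"]
    by (simp only: Suc funpow_trajectory_inv)
\<comment> \<open>At \<open>n = 0\<close> both trajectories are the dummy value
  \<open>x\<close>.\<close>
qed simp

theorem lemma3p9:
  fixes v :: "'a::ab_semigroup_mult \<Rightarrow> real" and \<phi> :: "'a \<Rightarrow> 'a"
  assumes "normed_semigroup v"
    and "normed_semigroup_automorphism v \<phi>"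
  shows "semigroup_entropy v (inv \<phi>) = semigroup_entropy v \<phi>"
  by (simp add: semigroup_entropy_def entropy_at_def norm_trajectory_inv[OF assms(2)])

end
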